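(* Let $n \ge 3$ and let $\boldsymbol{a} = (a_1, a_2, \ldots, a_n)^T$ be a vector of positive integers with $a_1 \le a_2 \le \cdots \le a_n$ whose entries are pairwise coprime, i.e. $\gcd(a_i,a_j)=1$ for all $i,j\in\{1,\ldots,n\}$ with $i \neq j$. Then $F(\boldsymbol{a}) \le UB_1(\boldsymbol{a})$ and $F(\boldsymbol{a}) \le UB_2(\boldsymbol{a})$, where $UB_2(\boldsymbol{a})$ is sharper only when $$ \begin{aligned} (a_1,a_2,a_3) \in \{&(1,2,3),(1,2,5),(1,2,7),(1,2,9),(1,2,11),(1,2,13),(1,2,15),\\ &(1,2,17),(1,2,19),(1,2,21),(1,2,23),(1,2,25),(1,3,4),(1,3,5),\\ &(1,3,7),(1,3,8),(1,3,10),(1,3,11),(1,3,13),(1,3,14),(1,4,5),\\ &(1,4,7),(1,4,9),(1,4,11),(1,5,6),(1,5,7),(1,5,8),(1,5,9),(1,6,7),(2,3,5)\}. \end{aligned} $$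
   Context: For a vector $\boldsymbol{a}=(a_1,\ldots,a_n)^T$ of positive integers with $n\ge 2$ and $\gcd(a_1,\ldots,a_n)=1$, the Frobenius number is $F(\boldsymbol{a}) := \max\{ b \in \mathbb{Z} : b \ne \sum_{i=1}^n a_i z_i \text{ for all } (z_1,\ldots,z_n) \in \mathbb{Z}_{\ge 0}^n \}$, the largest integer (possibly negative) that is not a nonnegative integer combination of the $a_i$. The two bounds depend only on the first three entries of $\boldsymbol{a}$ and are $$UB_1(\boldsymbol{a}) = UB_1(a_1,a_2,a_3) := \frac{1}{2}\left(\sqrt{\frac{1}{3}(a_1+a_2+a_3)(a_1+a_2+a_3+2a_1a_2a_3)+\frac{8}{3}(a_1a_2+a_2a_3+a_3a_1)}-a_1-a_2-a_3\right),$$ $$UB_2(\boldsymbol{a}) = UB_2(a_1,a_2,a_3) := \frac{1}{2}\left(\sqrt{a_1a_2a_3(a_1+a_2+a_3)}-a_1-a_2-a_3\right).$$ Here "sharper" means giving the smaller (tighter) upper bound of the two.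
   Formalization: The "sharper only when" clause is proved with the additional exception a_1 = a_2 = 1, because for every (1,1,k) UB_2 is strictly smaller than UB_1 (under the roots k^2+2k versus k^2+8k+4) although (1,1,k) is not in the list. *)

theory Defs
  imports Complex_Main
begin

text \<open>A vector \<open>(a\<^sub>1, \<dots>, a\<^sub>n)\<close> is a function on \<open>nat\<close> of which only the values at
  \<open>1, \<dots>, n\<close> matter.  The maximum ranges over a set of integers that is unbounded below, so
  \<open>Max\<close> (which is for finite sets) does not apply; \<open>GREATEST\<close> is the largest element whenever
  one exists, which is the case for positive entries with greatest common divisor 1.\<close>

definition frobenius_number :: "nat \<Rightarrow> (nat \<Rightarrow> nat) \<Rightarrow> int" where
  "frobenius_number n a =
     (GREATEST b::int. \<forall>z::nat \<Rightarrow> nat. b \<noteq> (\<Sum>i=1..n. int (a i) * int (z i)))"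

definition UB1 :: "real \<Rightarrow> real \<Rightarrow> real \<Rightarrow> real" where
  "UB1 x y z = 1/2 * (sqrt (1/3 * (x + y + z) * (x + y + z + 2 * x * y * z)
                            + 8/3 * (x * y + y * z + z * x)) - x - y - z)"

definition UB2 :: "real \<Rightarrow> real \<Rightarrow> real \<Rightarrow> real" where
  "UB2 x y z = 1/2 * (sqrt (x * y * z * (x + y + z)) - x - y - z)"

end

theory Submission
  imports Defs "HOL-Number_Theory.Cong"
begin

text \<open>
  Let \<open>a, b, c\<close> be pairwise coprime, \<open>M = abc\<close>, \<open>s = a + b + c\<close>, and let \<open>r \<ge> -1\<close> not be of the
  form \<open>ax + by + cz\<close>.  In the box \<open>x < bc\<close>, \<open>y < ac\<close>, \<open>z < ab\<close> there are exactly \<open>M\<close> points with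
  \<open>ax + by + cz \<equiv> r (mod M)\<close>, and by the assumption on \<open>r\<close> the value there is always \<open>r + M\<close> or
  \<open>r + 2M\<close>.  Hence, with \<open>V\<close> the doubled deviation of \<open>ax + by + cz\<close> from its mean and
  \<open>R = 2r + s\<close>, one has \<open>(V - R)\<^sup>2 = M\<^sup>2\<close> at every such point, so \<open>R\<^sup>2 = M\<^sup>2 - E[V\<^sup>2]\<close> on average.
  The variances of \<open>x, y, z\<close> are known exactly, and the covariance of \<open>x\<close> and \<open>y\<close> is that of
  \<open>x mod c\<close> and \<open>y mod c\<close>, each a permutation of \<open>{0..<c}\<close>, so it is at least
  \<open>-(c\<^sup>2 - 1)/12\<close> by Cauchy-Schwarz.  This yields
  \<open>3R\<^sup>2 \<le> a\<^sup>2 + b\<^sup>2 + c\<^sup>2 + 2Ms - 2(ab + bc + ca)\<close>, which is stronger than both bounds.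
\<close>

section \<open>Centred uniform residues\<close>

text \<open>Twice the deviation of \<open>k\<close> from the mean of \<open>{0..<m}\<close>; the factor avoids fractions.\<close>

definition centered :: "nat \<Rightarrow> nat \<Rightarrow> int" where
  "centered m k = 2 * int k - int m + 1"

lemma sum_centered: "(\<Sum>k<m. centered m k) = 0"
proof -
  \<comment> \<open>The offset is generalised to \<open>c\<close> because \<open>m\<close> occurs in
    the summand as well as in the range, which would block the induction.\<close>
  have "(\<Sum>k<m. 2 * int k + c) = int m * (int m - 1 + c)" for c
    by (induction m) (auto simp: algebra_simps)
  from this[of "1 - int m"] show ?thesis
    by (simp add: centered_def algebra_simps)
qed

text \<open>The uniform distribution on {0..<m} has variance (m^2 - 1)/12. Doubling the deviations
  multiplies it by 4, summing instead of averaging by m, and the factor 3 clears the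
  denominator.\<close>

lemma sum_centered_sq: "3 * (\<Sum>k<m. (centered m k)\<^sup>2) = int m * ((int m)\<^sup>2 - 1)"
proof -
  have "3 * (\<Sum>k<m. (2 * int k + c)\<^sup>2)
      = int m * (2 * (int m - 1) * (2 * int m - 1) + 6 * c * (int m - 1) + 3 * c\<^sup>2)" for c
    by (induction m) (auto simp: algebra_simps power2_eq_square)
  from this[of "1 - int m"] show ?thesis
    by (simp add: centered_def algebra_simps power2_eq_square)
qed

text \<open>In base c, u is the low digit and i the high one. The centring offsets combine as 1 - bc
  = (1 - c) + c(1 - b), so each digit is centred by itself.\<close>

lemma centered_digits: "centered (b * c) (u + c * i) = centered c u + int c * centered b i"
  by (simp add: centered_def algebra_simps)

section \<open>Solution sets of linear congruences\<close>

definition residue_pairs :: "nat \<Rightarrow> nat \<Rightarrow> nat \<Rightarrow> int \<Rightarrow> (nat \<times> nat) set" where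
  "residue_pairs a b c r =
     {(x, y). x < b * c \<and> y < a * c \<and> int c dvd int (a * x + b * y) - r}"

text \<open>Each coordinate runs over one full period: modulo abc, the term ax depends only on x
  modulo bc, and likewise for by and cz.\<close>

definition residue_triples :: "nat \<Rightarrow> nat \<Rightarrow> nat \<Rightarrow> int \<Rightarrow> (nat \<times> nat \<times> nat) set" where
  "residue_triples a b c r =
     {(x, y, z). x < b * c \<and> y < a * c \<and> z < a * b \<and>
        int (a * b * c) dvd int (a * x + b * y + c * z) - r}"

lemma linear_cong_solution:
  fixes b c :: nat and w :: int
  assumes "coprime b c" "c > 0"
  obtains v where "v < c" "int c dvd int b * int v - w"
proof -
  have "coprime (int b) (int c)" using assms by simp
  then obtain t where t: "[int b * t = 1] (mod int c)"
    using cong_solve_coprime_int by blast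
  define v where "v = nat ((t * w) mod int c)"
  have v: "int v = (t * w) mod int c" using assms by (simp add: v_def)
  have "[int b * int v = int b * (t * w)] (mod int c)"
    unfolding v by (simp add: cong_def mod_mult_right_eq)
  also have "int b * (t * w) = (int b * t) * w" by simp
  also have "[(int b * t) * w = 1 * w] (mod int c)"
    by (rule cong_mult[OF t cong_refl])
  finally have "int c dvd int b * int v - w"
    by (simp add: cong_iff_dvd_diff)
  moreover have "v < c" using v assms(2)
    by (metis of_nat_0_less_iff of_nat_less_iff pos_mod_bound)
  ultimately show thesis using that by blast
qed

lemma linear_cong_unique:
  fixes b c v v' :: nat and w :: int
  assumes "coprime b c" "v < c" "v' < c"
    "int c dvd int b * int v - w" "int c dvd int b * int v' - w"
  shows "v = v'"
proof -
  have "int c dvd (int b * int v - w) - (int b * int v' - w)"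
    using assms(4,5) by (rule dvd_diff)
  then have "int c dvd int b * (int v - int v')"
    by (simp add: algebra_simps)
  moreover have "coprime (int c) (int b)" using assms(1) by (simp add: coprime_commute)
  ultimately have "int c dvd int v - int v'"
    by (simp add: coprime_dvd_mult_right_iff)
  then have "[v = v'] (mod c)"
    by (simp add: cong_iff_dvd_diff flip: cong_int_iff)
  then show ?thesis using assms by (simp add: cong_def)
qed

text \<open>The congruence modulo abc splits by the Chinese remainder theorem. Modulo c it does not
  involve z; modulo ab the factor c is invertible, so z is determined by x and y. Sums that involve
  only two coordinates thereby reduce to pairs.\<close>

lemma bij_betw_residue_triples:
  assumes "coprime a c" "coprime b c" "a > 0" "b > 0"
  shows "bij_betw (\<lambda>(x, y, z). (x, y)) (residue_triples a b c r) (residue_pairs a b c r)"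
proof -
  have cop: "coprime c (a * b)"
    using assms by (simp add: coprime_commute)
  have split: "int (a * b * c) dvd int (a * x + b * y + c * z) - r \<longleftrightarrow>
      int (a * b) dvd int c * int z - (r - int (a * x + b * y)) \<and> int c dvd int (a * x + b * y) - r"
    for x y z
  proof -
    have "int (a * b * c) dvd m \<longleftrightarrow> int (a * b) dvd m \<and> int c dvd m" for m
    proof
      assume "int (a * b * c) dvd m"
      then show "int (a * b) dvd m \<and> int c dvd m"
        by (metis dvd_mult_left dvd_mult_right of_nat_mult)
    next
      assume "int (a * b) dvd m \<and> int c dvd m"
      moreover have "coprime (int (a * b)) (int c)"
        using cop by (metis coprime_commute coprime_int_iff)
      ultimately show "int (a * b * c) dvd m"
        by (metis divides_mult of_nat_mult)
    qed
    moreover have "int c dvd int (a * x + b * y + c * z) - r \<longleftrightarrow> int c dvd int (a * x + b * y) - r"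
    proof -
      have "int (a * x + b * y + c * z) - r = (int (a * x + b * y) - r) + int c * int z"
        by simp
      then show ?thesis by (metis dvd_add_left_iff dvd_triv_left)
    qed
    moreover have "int (a * x + b * y + c * z) - r = int c * int z - (r - int (a * x + b * y))"
      by simp
    ultimately show ?thesis by metis
  qed
  show ?thesis unfolding bij_betw_def
  proof
    show "inj_on (\<lambda>(x, y, z). (x, y)) (residue_triples a b c r)"
      by (rule inj_onI)
        (auto simp del: of_nat_add of_nat_mult simp: residue_triples_def split
          intro: linear_cong_unique[OF cop])
    have "(x, y) \<in> (\<lambda>(x, y, z). (x, y)) ` residue_triples a b c r"
      if xy: "(x, y) \<in> residue_pairs a b c r" for x y
    proof -
      obtain z where "z < a * b" "int (a * b) dvd int c * int z - (r - int (a * x + b * y))"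
        using linear_cong_solution[OF cop] assms by (metis nat_0_less_mult_iff)
      then have "(x, y, z) \<in> residue_triples a b c r"
        using xy unfolding residue_triples_def residue_pairs_def mem_Collect_eq case_prod_conv split
        by simp
      then show ?thesis by force
    qed
    moreover have "(\<lambda>(x, y, z). (x, y)) ` residue_triples a b c r \<subseteq> residue_pairs a b c r"
      by (auto simp del: of_nat_add of_nat_mult simp: residue_triples_def residue_pairs_def split)
    ultimately show "(\<lambda>(x, y, z). (x, y)) ` residue_triples a b c r = residue_pairs a b c r"
      by auto
  qed
qed

text \<open>Modulo c the residue of y is determined by that of x because b is invertible. The
  resulting map is injective because a is invertible too, hence a permutation of the
  residues.\<close>

lemma ex_complementary_residue:
  fixes r :: int
  assumes "coprime a c" "coprime b c" "c > 0"
  obtains \<pi> where "bij_betw \<pi> {..<c} {..<c}"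
    "\<And>x y. int c dvd int (a * x + b * y) - r \<longleftrightarrow> y mod c = \<pi> (x mod c)"
proof -
  have "\<exists>v. v < c \<and> int c dvd int b * int v - (r - int (a * u))" for u
    using linear_cong_solution[OF assms(2,3)] by metis
  then obtain \<pi> where \<pi>: "\<pi> u < c" "int c dvd int b * int (\<pi> u) - (r - int (a * u))" for u
    by metis
  have red: "int c dvd int (a * x + b * y) - r \<longleftrightarrow>
      int c dvd int (a * (x mod c) + b * (y mod c)) - r" for x y
  proof -
    have "[int x = int (x mod c)] (mod int c)" "[int y = int (y mod c)] (mod int c)"
      by (simp_all add: cong_def zmod_int)
    then have "[int (a * x + b * y) - r = int (a * (x mod c) + b * (y mod c)) - r] (mod int c)"
      unfolding of_nat_add of_nat_mult
      by (intro cong_diff cong_add cong_mult cong_refl)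
    then show ?thesis by (rule cong_dvd_iff)
  qed
  have iff: "int c dvd int (a * x + b * y) - r \<longleftrightarrow> y mod c = \<pi> (x mod c)" for x y
  proof -
    have eq: "int (a * (x mod c) + b * v) - r = int b * int v - (r - int (a * (x mod c)))" for v
      by simp
    show ?thesis
      unfolding red[of x y] eq
      using \<pi>[of "x mod c"] linear_cong_unique[OF assms(2), of "y mod c" "\<pi> (x mod c)"] assms(3)
      by (metis mod_less_divisor)
  qed
  have "inj_on \<pi> {..<c}"
  proof (rule inj_onI)
    fix u u' assume u: "u \<in> {..<c}" "u' \<in> {..<c}" "\<pi> u = \<pi> u'"
    have "int c dvd int (a * u + b * \<pi> u) - r" "int c dvd int (a * u' + b * \<pi> u) - r"
      unfolding iff using u \<pi>(1) by auto
    moreover have "int (a * w + b * \<pi> u) - r = int a * int w - (r - int (b * \<pi> u))" for w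
      by simp
    ultimately show "u = u'"
      using linear_cong_unique[OF assms(1), of u u'] u by (metis lessThan_iff)
  qed
  moreover have "\<pi> ` {..<c} \<subseteq> {..<c}" using \<pi>(1) by auto
  ultimately have "bij_betw \<pi> {..<c} {..<c}"
    by (simp add: bij_betw_def endo_inj_surj)
  then show thesis using iff that by blast
qed

text \<open>Writing x and y in base c, the congruence constrains only the low digits u and
  \<open>\<pi> u\<close>; the high digits i < b and j < a are free.\<close>

lemma sum_residue_pairs:
  fixes f :: "nat \<times> nat \<Rightarrow> int"
  assumes "c > 0" "\<And>u. u < c \<Longrightarrow> \<pi> u < c"
    "\<And>x y. int c dvd int (a * x + b * y) - r \<longleftrightarrow> y mod c = \<pi> (x mod c)"
  shows "(\<Sum>p\<in>residue_pairs a b c r. f p)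
    = (\<Sum>u<c. \<Sum>i<b. \<Sum>j<a. f (u + c * i, \<pi> u + c * j))"
proof -
  have bound: "u + c * i < b * c" if "u < c" "i < b" for u i b
  proof -
    have "u + c * i < c * Suc i" using that by simp
    also have "\<dots> \<le> c * b" using that by (intro mult_le_mono) auto
    finally show ?thesis by (simp add: mult.commute)
  qed
  have "(\<Sum>p\<in>residue_pairs a b c r. f p)
      = (\<Sum>(u, i, j)\<in>{..<c} \<times> {..<b} \<times> {..<a}. f (u + c * i, \<pi> u + c * j))"
  proof (rule sum.reindex_bij_witness[where j = "\<lambda>(x, y). (x mod c, x div c, y div c)"
        and i = "\<lambda>(u, i, j). (u + c * i, \<pi> u + c * j)"], goal_cases)
    case (1 p)
    then show ?case unfolding residue_pairs_def assms(3) by auto (metis mod_mult_div_eq)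
  next
    case (2 p)
    then show ?case
      unfolding residue_pairs_def assms(3) using assms(1) by (auto simp: less_mult_imp_div_less)
  next
    case (3 t)
    then show ?case using assms(2) by auto
  next
    case (4 t)
    then show ?case unfolding residue_pairs_def assms(3) using assms(2) by (auto simp: bound)
  next
    case (5 p)
    then show ?case unfolding residue_pairs_def assms(3) by auto (metis mod_mult_div_eq)
  qed
  then show ?thesis
    by (simp add: sum.cartesian_product)
qed

section \<open>Moments over the solution sets\<close>

text \<open>Every x < bc occurs equally often, namely a times, so its mean and variance are those of
  a uniform variable. The coordinates x and y are correlated only through their low digits, which
  are linked by a permutation.\<close>

lemma residue_pairs_moments:
  fixes a b c :: nat and r :: int
  assumes "coprime a c" "coprime b c" "c > 0"
  defines "T \<equiv> residue_pairs a b c r"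
  shows "card T = a * b * c"
    and "(\<Sum>(x, y)\<in>T. centered (b * c) x) = 0"
    and "3 * (\<Sum>(x, y)\<in>T. (centered (b * c) x)\<^sup>2) = int (a * b * c) * ((int (b * c))\<^sup>2 - 1)"
    and "3 * (\<Sum>(x, y)\<in>T. centered (b * c) x * centered (a * c) y)
      \<ge> - int (a * b * c) * ((int c)\<^sup>2 - 1)"
proof -
  obtain \<pi> where bij: "bij_betw \<pi> {..<c} {..<c}"
    and \<pi>: "\<And>x y. int c dvd int (a * x + b * y) - r \<longleftrightarrow> y mod c = \<pi> (x mod c)"
    using ex_complementary_residue[OF assms(1-3)] by metis
  have sumT: "sum f T = (\<Sum>u<c. \<Sum>i<b. \<Sum>j<a. f (u + c * i, \<pi> u + c * j))"
    for f :: "nat \<times> nat \<Rightarrow> int"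
    unfolding T_def
    by (rule sum_residue_pairs) (use assms(3) bij_betw_apply[OF bij] \<pi> in auto)
  have "int (card T) = (\<Sum>p\<in>T. 1)" by simp
  also have "\<dots> = int (a * b * c)" unfolding sumT by simp
  finally show "card T = a * b * c" by linarith
  show "(\<Sum>(x, y)\<in>T. centered (b * c) x) = 0"
    unfolding sumT
    by (simp add: centered_digits sum.distrib sum_centered flip: sum_distrib_left)
  have "(\<Sum>(x, y)\<in>T. (centered (b * c) x)\<^sup>2)
      = int a * (\<Sum>u<c. \<Sum>i<b. (centered c u + int c * centered b i)\<^sup>2)"
    unfolding sumT by (simp add: centered_digits sum_distrib_left)
  also have "(\<Sum>u<c. \<Sum>i<b. (centered c u + int c * centered b i)\<^sup>2)
      = (\<Sum>u<c. int b * (centered c u)\<^sup>2 + (int c)\<^sup>2 * (\<Sum>i<b. (centered b i)\<^sup>2))"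
  proof (rule sum.cong[OF refl])
    fix u
    have "(\<Sum>i<b. (centered c u + int c * centered b i)\<^sup>2)
        = (\<Sum>i<b. (centered c u)\<^sup>2 + (int c)\<^sup>2 * (centered b i)\<^sup>2
             + (2 * int c * centered c u) * centered b i)"
      by (intro sum.cong refl) (simp add: power2_eq_square algebra_simps)
    also have "\<dots> = int b * (centered c u)\<^sup>2 + (int c)\<^sup>2 * (\<Sum>i<b. (centered b i)\<^sup>2)"
      by (simp add: sum.distrib sum_centered flip: sum_distrib_left)
    finally show "(\<Sum>i<b. (centered c u + int c * centered b i)\<^sup>2)
        = int b * (centered c u)\<^sup>2 + (int c)\<^sup>2 * (\<Sum>i<b. (centered b i)\<^sup>2)" .
  qed
  also have "\<dots> = int b * (\<Sum>u<c. (centered c u)\<^sup>2) + int c * (int c)\<^sup>2 * (\<Sum>i<b. (centered b i)\<^sup>2)"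
    by (simp add: sum.distrib flip: sum_distrib_left)
  finally have "3 * (\<Sum>(x, y)\<in>T. (centered (b * c) x)\<^sup>2)
      = int a * (int b * (3 * (\<Sum>u<c. (centered c u)\<^sup>2))
          + int c * (int c)\<^sup>2 * (3 * (\<Sum>i<b. (centered b i)\<^sup>2)))"
    by (simp add: algebra_simps)
  then show "3 * (\<Sum>(x, y)\<in>T. (centered (b * c) x)\<^sup>2) = int (a * b * c) * ((int (b * c))\<^sup>2 - 1)"
    unfolding sum_centered_sq by (simp add: algebra_simps power2_eq_square)
  have "(\<Sum>(x, y)\<in>T. centered (b * c) x * centered (a * c) y)
      = (\<Sum>u<c. (\<Sum>i<b. centered c u + int c * centered b i)
           * (\<Sum>j<a. centered c (\<pi> u) + int c * centered a j))"
    unfolding sumT by (simp add: centered_digits sum_product)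
  \<comment> \<open>The high digits are centred and free, so their contributions cancel; only their
    number ab remains.\<close>
  also have "\<dots> = int (a * b) * (\<Sum>u<c. centered c u * centered c (\<pi> u))"
    by (simp add: sum.distrib sum_centered sum_distrib_left algebra_simps
        flip: sum_distrib_left[of "int c"])
  finally have prod: "(\<Sum>(x, y)\<in>T. centered (b * c) x * centered (a * c) y)
      = int (a * b) * (\<Sum>u<c. centered c u * centered c (\<pi> u))" .
  \<comment> \<open>Cauchy-Schwarz in the form of a nonnegative sum of squares: since
    \<open>\<pi>\<close> is a permutation, both square sums agree and are known exactly.\<close>
  have "0 \<le> (\<Sum>u<c. (centered c u + centered c (\<pi> u))\<^sup>2)"
    by (intro sum_nonneg) auto
  also have "\<dots> = (\<Sum>u<c. (centered c u)\<^sup>2) + (\<Sum>u<c. (centered c (\<pi> u))\<^sup>2)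
      + 2 * (\<Sum>u<c. centered c u * centered c (\<pi> u))"
    by (simp add: power2_sum sum.distrib sum_distrib_left mult.assoc)
  also have "(\<Sum>u<c. (centered c (\<pi> u))\<^sup>2) = (\<Sum>u<c. (centered c u)\<^sup>2)"
    by (rule sum.reindex_bij_betw[OF bij])
  finally have "- (int c * ((int c)\<^sup>2 - 1)) \<le> 3 * (\<Sum>u<c. centered c u * centered c (\<pi> u))"
    using sum_centered_sq[of c] by linarith
  then have "int (a * b) * - (int c * ((int c)\<^sup>2 - 1))
      \<le> int (a * b) * (3 * (\<Sum>u<c. centered c u * centered c (\<pi> u)))"
    by (intro mult_left_mono) auto
  then show "3 * (\<Sum>(x, y)\<in>T. centered (b * c) x * centered (a * c) y)
      \<ge> - int (a * b * c) * ((int c)\<^sup>2 - 1)"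
    unfolding prod by (simp add: algebra_simps)
qed

lemma sum_residue_triples:
  fixes f :: "nat \<Rightarrow> nat \<Rightarrow> int"
  assumes "coprime a c" "coprime b c" "a > 0" "b > 0"
  shows "(\<Sum>(x, y, z)\<in>residue_triples a b c r. f x y) = (\<Sum>(x, y)\<in>residue_pairs a b c r. f x y)"
  using sum.reindex_bij_betw[OF bij_betw_residue_triples[OF assms], of "\<lambda>(x, y). f x y"]
  by (simp add: case_prod_unfold)

text \<open>This cyclic symmetry transfers the results on the pair (x, y) to (y, z) and (z,
  x).\<close>

lemma sum_residue_triples_rotate:
  fixes f :: "nat \<Rightarrow> nat \<Rightarrow> nat \<Rightarrow> int"
  shows "(\<Sum>(x, y, z)\<in>residue_triples a b c r. f x y z)
    = (\<Sum>(y, z, x)\<in>residue_triples b c a r. f x y z)"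
  by (rule sum.reindex_bij_witness[where i = "\<lambda>(y, z, x). (x, y, z)" and j = "\<lambda>(x, y, z). (y, z, x)"])
    (auto simp: residue_triples_def algebra_simps)

lemma residue_triples_moments:
  fixes a b c :: nat and r :: int
  assumes "coprime a b" "coprime a c" "coprime b c" "a > 0" "b > 0" "c > 0"
  defines "S \<equiv> residue_triples a b c r"
    and "V \<equiv> \<lambda>(x, y, z). int a * centered (b * c) x + int b * centered (a * c) y
      + int c * centered (a * b) z"
    and "M \<equiv> int (a * b * c)"
  shows "int (card S) = M"
    and "sum V S = 0"
    and "3 * (\<Sum>p\<in>S. (V p)\<^sup>2) \<ge> M * (3 * M\<^sup>2 - (int a)\<^sup>2 - (int b)\<^sup>2 - (int c)\<^sup>2
      - 2 * M * int (a + b + c) + 2 * int (a * b + b * c + c * a))"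
proof -
  note cop = assms(1-3) assms(1-3)[THEN coprime_commute[THEN iffD1]]
  have sum_xy: "(\<Sum>(x, y, z)\<in>S. f x y) = (\<Sum>(x, y)\<in>residue_pairs a b c r. f x y)"
    for f :: "nat \<Rightarrow> nat \<Rightarrow> int"
    unfolding S_def using sum_residue_triples cop assms(4-6) by blast
  have sum_yz: "(\<Sum>(x, y, z)\<in>S. f y z) = (\<Sum>(y, z)\<in>residue_pairs b c a r. f y z)"
    for f :: "nat \<Rightarrow> nat \<Rightarrow> int"
    unfolding S_def sum_residue_triples_rotate[of _ a b c]
    using sum_residue_triples[of b a c] cop assms(4-6) by blast
  have sum_zx: "(\<Sum>(x, y, z)\<in>S. f z x) = (\<Sum>(z, x)\<in>residue_pairs c a b r. f z x)"
    for f :: "nat \<Rightarrow> nat \<Rightarrow> int"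
    unfolding S_def sum_residue_triples_rotate[of _ a b c] sum_residue_triples_rotate[of _ b c a]
    using sum_residue_triples[of c b a] cop assms(4-6) by blast
  define X Y Z where "X = centered (b * c)" and "Y = centered (a * c)" and "Z = centered (a * b)"
  note mom_xy = residue_pairs_moments[where a = a and b = b and c = c and r = r]
  note mom_yz = residue_pairs_moments[where a = b and b = c and c = a and r = r]
  note mom_zx = residue_pairs_moments[where a = c and b = a and c = b and r = r]
  note prems = cop assms(4-6)
  have "int (card S) = (\<Sum>(x, y, z)\<in>S. 1)"
    by (simp add: case_prod_unfold)
  also have "\<dots> = M"
    unfolding sum_xy using mom_xy(1) prems by (simp add: case_prod_unfold M_def)
  finally show "int (card S) = M" .
  have X1: "(\<Sum>(x, y, z)\<in>S. X x) = 0"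
    unfolding sum_xy X_def using mom_xy(2) prems by simp
  have Y1: "(\<Sum>(x, y, z)\<in>S. Y y) = 0"
    unfolding sum_yz Y_def using mom_yz(2) prems by (simp add: mult.commute)
  have Z1: "(\<Sum>(x, y, z)\<in>S. Z z) = 0"
    unfolding sum_zx Z_def using mom_zx(2) prems by simp
  have X2: "3 * (\<Sum>(x, y, z)\<in>S. (X x)\<^sup>2) = M * ((int (b * c))\<^sup>2 - 1)"
    unfolding sum_xy X_def using mom_xy(3) prems by (simp add: M_def)
  have Y2: "3 * (\<Sum>(x, y, z)\<in>S. (Y y)\<^sup>2) = M * ((int (a * c))\<^sup>2 - 1)"
    unfolding sum_yz Y_def using mom_yz(3) prems by (simp add: M_def mult_ac)
  have Z2: "3 * (\<Sum>(x, y, z)\<in>S. (Z z)\<^sup>2) = M * ((int (a * b))\<^sup>2 - 1)"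
    unfolding sum_zx Z_def using mom_zx(3) prems by (simp add: M_def mult_ac)
  have XY: "3 * (\<Sum>(x, y, z)\<in>S. X x * Y y) \<ge> - M * ((int c)\<^sup>2 - 1)"
    unfolding sum_xy X_def Y_def using mom_xy(4) prems by (simp add: M_def)
  have YZ: "3 * (\<Sum>(x, y, z)\<in>S. Y y * Z z) \<ge> - M * ((int a)\<^sup>2 - 1)"
    unfolding sum_yz Y_def Z_def using mom_yz(4) prems by (simp add: M_def mult_ac)
  have ZX: "3 * (\<Sum>(x, y, z)\<in>S. Z z * X x) \<ge> - M * ((int b)\<^sup>2 - 1)"
    unfolding sum_zx Z_def X_def using mom_zx(4) prems by (simp add: M_def mult_ac)
  have V: "V = (\<lambda>(x, y, z). int a * X x + int b * Y y + int c * Z z)"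
    by (simp add: V_def X_def Y_def Z_def)
  have "sum V S = int a * (\<Sum>(x, y, z)\<in>S. X x) + int b * (\<Sum>(x, y, z)\<in>S. Y y)
      + int c * (\<Sum>(x, y, z)\<in>S. Z z)"
    by (simp add: V case_prod_unfold sum.distrib sum_distrib_left)
  then show "sum V S = 0" by (simp add: X1 Y1 Z1)
  have "(\<Sum>p\<in>S. (V p)\<^sup>2) = (\<Sum>(x, y, z)\<in>S. (int a)\<^sup>2 * (X x)\<^sup>2 + (int b)\<^sup>2 * (Y y)\<^sup>2
      + (int c)\<^sup>2 * (Z z)\<^sup>2 + 2 * int (a * b) * (X x * Y y) + 2 * int (b * c) * (Y y * Z z)
      + 2 * int (c * a) * (Z z * X x))"
    by (intro sum.cong refl) (auto simp: V power2_eq_square algebra_simps)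
  also have "\<dots> = (int a)\<^sup>2 * (\<Sum>(x, y, z)\<in>S. (X x)\<^sup>2) + (int b)\<^sup>2 * (\<Sum>(x, y, z)\<in>S. (Y y)\<^sup>2)
      + (int c)\<^sup>2 * (\<Sum>(x, y, z)\<in>S. (Z z)\<^sup>2)
      + 2 * int (a * b) * (\<Sum>(x, y, z)\<in>S. X x * Y y)
      + 2 * int (b * c) * (\<Sum>(x, y, z)\<in>S. Y y * Z z)
      + 2 * int (c * a) * (\<Sum>(x, y, z)\<in>S. Z z * X x)"
    by (simp add: case_prod_unfold sum.distrib sum_distrib_left)
  finally have "3 * (\<Sum>p\<in>S. (V p)\<^sup>2)
      = (int a)\<^sup>2 * (3 * (\<Sum>(x, y, z)\<in>S. (X x)\<^sup>2)) + (int b)\<^sup>2 * (3 * (\<Sum>(x, y, z)\<in>S. (Y y)\<^sup>2))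
      + (int c)\<^sup>2 * (3 * (\<Sum>(x, y, z)\<in>S. (Z z)\<^sup>2))
      + 2 * int (a * b) * (3 * (\<Sum>(x, y, z)\<in>S. X x * Y y))
      + 2 * int (b * c) * (3 * (\<Sum>(x, y, z)\<in>S. Y y * Z z))
      + 2 * int (c * a) * (3 * (\<Sum>(x, y, z)\<in>S. Z z * X x))"
    by linarith
  \<comment> \<open>The variances are exact, and the covariances carry the nonnegative coefficients
    2ab, 2bc, 2ca, so lower bounds on them suffice.\<close>
  also have "\<dots> \<ge> (int a)\<^sup>2 * (M * ((int (b * c))\<^sup>2 - 1)) + (int b)\<^sup>2 * (M * ((int (a * c))\<^sup>2 - 1))
      + (int c)\<^sup>2 * (M * ((int (a * b))\<^sup>2 - 1))
      + 2 * int (a * b) * (- M * ((int c)\<^sup>2 - 1)) + 2 * int (b * c) * (- M * ((int a)\<^sup>2 - 1))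
      + 2 * int (c * a) * (- M * ((int b)\<^sup>2 - 1))"
    unfolding X2 Y2 Z2 by (intro add_mono mult_left_mono XY YZ ZX order_refl) auto
  also have "(int a)\<^sup>2 * (M * ((int (b * c))\<^sup>2 - 1)) + (int b)\<^sup>2 * (M * ((int (a * c))\<^sup>2 - 1))
      + (int c)\<^sup>2 * (M * ((int (a * b))\<^sup>2 - 1))
      + 2 * int (a * b) * (- M * ((int c)\<^sup>2 - 1)) + 2 * int (b * c) * (- M * ((int a)\<^sup>2 - 1))
      + 2 * int (c * a) * (- M * ((int b)\<^sup>2 - 1))
    = M * (3 * M\<^sup>2 - (int a)\<^sup>2 - (int b)\<^sup>2 - (int c)\<^sup>2
      - 2 * M * int (a + b + c) + 2 * int (a * b + b * c + c * a))"
    by (simp add: M_def power2_eq_square algebra_simps)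
  finally show "3 * (\<Sum>p\<in>S. (V p)\<^sup>2) \<ge> M * (3 * M\<^sup>2 - (int a)\<^sup>2 - (int b)\<^sup>2 - (int c)\<^sup>2
      - 2 * M * int (a + b + c) + 2 * int (a * b + b * c + c * a))" .
qed

section \<open>The quadratic bound for nonrepresentable integers\<close>

lemma nonrepresentable_bound:
  fixes a b c :: nat and r :: int
  assumes "coprime a b" "coprime a c" "coprime b c" "a > 0" "b > 0" "c > 0"
    and nonrep: "\<And>x y z :: nat. r \<noteq> int (a * x + b * y + c * z)"
    and "r \<ge> -1"
  shows "3 * (2 * r + int (a + b + c))\<^sup>2 \<le> (int a)\<^sup>2 + (int b)\<^sup>2 + (int c)\<^sup>2
    + 2 * int (a * b * c) * int (a + b + c) - 2 * int (a * b + b * c + c * a)"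
proof -
  define S V M where "S = residue_triples a b c r"
    and "V = (\<lambda>(x, y, z). int a * centered (b * c) x + int b * centered (a * c) y
      + int c * centered (a * b) z)"
    and "M = int (a * b * c)"
  note mom = residue_triples_moments[OF assms(1-6), of r, folded S_def V_def M_def]
  define R where "R = 2 * r + int (a + b + c)"
  have "M > 0" using assms(4-6) by (simp add: M_def)
  have V_R: "(V p - R)\<^sup>2 = M\<^sup>2" if "p \<in> S" for p
  proof -
    obtain x y z where p: "p = (x, y, z)" by (cases p)
    define v where "v = int (a * x + b * y + c * z)"
    have bounds: "x < b * c" "y < a * c" "z < a * b" and "M dvd v - r"
      using that by (auto simp del: of_nat_add of_nat_mult
          simp: p S_def M_def v_def residue_triples_def)
    then obtain j where j: "v = r + M * j" by (metis add_diff_cancel_left' diff_add_cancel dvdE add.commute)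
    have "int a * int x \<le> int a * (int (b * c) - 1)" "int b * int y \<le> int b * (int (a * c) - 1)"
      "int c * int z \<le> int c * (int (a * b) - 1)"
      using bounds by (intro mult_left_mono; simp flip: of_nat_mult)+
    then have "v \<le> 3 * M - int (a + b + c)"
      by (simp add: v_def M_def algebra_simps)
    \<comment> \<open>Here a + b + c \<ge> 3 and r \<ge> -1, so Mj = v - r \<le> 3M - 3 + 1 <
      3M.\<close>
    then have "M * j < M * 3" using j assms(4-6,8) by auto
    then have "j < 3" using \<open>M > 0\<close> by simp
    moreover have "j > 0"
    \<comment> \<open>For j \<le> 0 the surplus -Mj = a(bc(-j)) can be absorbed into the coefficient
      of a, which would represent r.\<close>
    proof (rule ccontr)
      assume "\<not> j > 0"
      then have "r = int (a * (x + b * c * nat (- j)) + b * y + c * z)"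
        using j by (simp add: v_def M_def algebra_simps)
      then show False using nonrep by blast
    qed
    ultimately have "j = 1 \<or> j = 2" by linarith
    \<comment> \<open>Over the box, twice the mean of v is 3M - (a + b + c). For j = 1 or j = 2 the
      factor 2j - 3 below is -1 or 1, so both cases give the same square.\<close>
    moreover have "V p = 2 * v - 3 * M + int (a + b + c)"
      by (simp add: V_def p v_def M_def centered_def algebra_simps)
    then have "V p - R = M * (2 * j - 3)"
      by (simp add: R_def j algebra_simps)
    ultimately show ?thesis by auto
  qed
  have "int (card S) * M\<^sup>2 = (\<Sum>p\<in>S. (V p - R)\<^sup>2)"
    by (simp add: V_R)
  also have "\<dots> = (\<Sum>p\<in>S. (V p)\<^sup>2) - 2 * R * sum V S + int (card S) * R\<^sup>2"
    by (simp add: power2_diff sum.distrib sum_subtractf mult_ac flip: sum_distrib_left sum_distrib_right)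
  finally have "M * M\<^sup>2 = (\<Sum>p\<in>S. (V p)\<^sup>2) + M * R\<^sup>2"
    by (simp add: mom(1,2))
  then have "M * (3 * R\<^sup>2) = M * (3 * M\<^sup>2) - 3 * (\<Sum>p\<in>S. (V p)\<^sup>2)"
    by (simp add: algebra_simps)
  also have "\<dots> \<le> M * (3 * M\<^sup>2) - M * (3 * M\<^sup>2 - (int a)\<^sup>2 - (int b)\<^sup>2 - (int c)\<^sup>2
      - 2 * M * int (a + b + c) + 2 * int (a * b + b * c + c * a))"
    using mom(3) by linarith
  also have "\<dots> = M * ((int a)\<^sup>2 + (int b)\<^sup>2 + (int c)\<^sup>2 + 2 * M * int (a + b + c)
      - 2 * int (a * b + b * c + c * a))"
    by (simp add: algebra_simps)
  finally have "3 * R\<^sup>2 \<le> (int a)\<^sup>2 + (int b)\<^sup>2 + (int c)\<^sup>2 + 2 * M * int (a + b + c)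
      - 2 * int (a * b + b * c + c * a)"
    using \<open>M > 0\<close> by (rule mult_left_le_imp_le)
  then show ?thesis
    unfolding R_def M_def .
qed

section \<open>Comparison of the two bounds\<close>

text \<open>The bounds differ only in their radicands. After multiplication by 3, a term 2xyz(x + y
  + z) cancels and an inequality of natural numbers remains.\<close>

lemma UB2_less_UB1_imp:
  fixes x y z :: nat
  assumes "x > 0" "y > 0" "z > 0"
    and "UB2 (real x) (real y) (real z) < UB1 (real x) (real y) (real z)"
  shows "x * y * z * (x + y + z) < (x + y + z)\<^sup>2 + 8 * (x * y + y * z + z * x)"
proof -
  have "sqrt (real x * real y * real z * (real x + real y + real z))
      < sqrt (1/3 * (real x + real y + real z) * (real x + real y + real z + 2 * real x * real y * real z)
          + 8/3 * (real x * real y + real y * real z + real z * real x))"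
    using assms(4) by (simp add: UB1_def UB2_def)
  then have "3 * (real x * real y * real z * (real x + real y + real z))
      < (real x + real y + real z) * (real x + real y + real z + 2 * real x * real y * real z)
        + 8 * (real x * real y + real y * real z + real z * real x)"
    by (simp add: field_simps)
  then have "real (x * y * z * (x + y + z)) < real ((x + y + z)\<^sup>2 + 8 * (x * y + y * z + z * x))"
    by (simp add: power2_eq_square algebra_simps)
  then show ?thesis by (simp only: of_nat_less_iff)
qed

lemma UB2_sharper_cases:
  fixes x y z :: nat
  assumes "x > 0" "x < y" "y < z" "coprime x y" "coprime x z" "coprime y z"
    and *: "x * y * z * (x + y + z) < (x + y + z)\<^sup>2 + 8 * (x * y + y * z + z * x)"
  shows "(x, y, z) \<in>
       {(1,2,3), (1,2,5), (1,2,7), (1,2,9), (1,2,11), (1,2,13), (1,2,15),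
        (1,2,17), (1,2,19), (1,2,21), (1,2,23), (1,2,25), (1,3,4), (1,3,5),
        (1,3,7), (1,3,8), (1,3,10), (1,3,11), (1,3,13), (1,3,14), (1,4,5),
        (1,4,7), (1,4,9), (1,4,11), (1,5,6), (1,5,7), (1,5,8), (1,5,9), (1,6,7), (2,3,5)}"
proof -
  have "3 * (x * y + y * z + z * x) \<le> (x + y + z)\<^sup>2"
  proof -
    have "0 \<le> (int x - int y)\<^sup>2 + (int y - int z)\<^sup>2 + (int z - int x)\<^sup>2" by simp
    then have "int (3 * (x * y + y * z + z * x)) \<le> int ((x + y + z)\<^sup>2)"
      by (simp add: power2_eq_square algebra_simps)
    then show ?thesis by (simp only: of_nat_le_iff)
  qed
  \<comment> \<open>The constant is 11 = 3 + 8: three times the hypothesis gives 3 squares of the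
    sum, and 24(xy + yz + zx) is at most 8 more.\<close>
  then have "3 * (x * y * z * (x + y + z)) < 11 * (x + y + z)\<^sup>2" using * by linarith
  then have "(3 * (x * y * z)) * (x + y + z) < (11 * (x + y + z)) * (x + y + z)"
    by (simp add: power2_eq_square algebra_simps)
  then have lin: "3 * (x * y * z) < 11 * (x + y + z)"
    by (metis mult_less_cancel2)
  also have "\<dots> < 11 * (3 * z)" using assms(2,3) by simp
  finally have "(x * y) * z < 11 * z" by simp
  then have xy: "x * y \<le> 10" by simp
  have "x \<le> 2"
  proof (rule ccontr)
    assume "\<not> x \<le> 2"
    then have "3 * 4 \<le> x * y" using assms(2) by (intro mult_le_mono) auto
    then show False using xy by simp
  qed
  then have "x = 1 \<or> x = 2" using assms(1) by linarith
  moreover have "y \<le> 10" using xy assms(1) by (cases x) auto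
  then have "y \<in> {2,3,4,5,6,7,8,9,10}" using assms(1,2) by auto
  ultimately have "x = 1 \<and> y \<in> {2,3,4,5,6,7,8,9,10} \<or> x = 2 \<and> y \<in> {3,5}"
    using assms(2,4) xy by auto
  then have pairs: "(x, y) \<in> {(1,2), (1,3), (1,4), (1,5), (1,6), (1,7), (1,8), (1,9), (1,10), (2,3), (2,5)}"
    by auto
  \<comment> \<open>The pair (1, 2) is the least restrictive: there the inequality amounts to (z -
    25)(z + 1) < 0. After substituting z = 26 + w it fails coefficientwise in w for every
    pair.\<close>
  have "z \<le> 25"
  proof (rule ccontr)
    assume "\<not> z \<le> 25"
    then obtain w where "z = 26 + w" using le_Suc_ex[of 26 z] by auto
    then show False using * pairs by (auto simp: power2_eq_square algebra_simps)
  qed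
  then have "z \<in> set [2..<26]"
    using assms(1-3) by (simp only: set_upt atLeastLessThan_iff) linarith
  then have z: "z \<in> {2,3,4,5,6,7,8,9,10,11,12,13,14,15,16,17,18,19,20,21,22,23,24,25}"
    by (simp del: set_upt)
  have gcd: "gcd x z = 1" "gcd y z = 1" using assms(5,6) by simp_all
  \<comment> \<open>The triples (1,4,6), (1,4,10) and (1,6,8) satisfy the inequality and are
    excluded by these values.\<close>
  have gcds: "gcd 4 6 = (2::nat)" "gcd 4 10 = (2::nat)" "gcd 6 8 = (2::nat)"
    by code_simp+
  show ?thesis
    using pairs
    by (simp only: insert_iff empty_iff prod.inject simp_thms)
      (elim disjE conjE; use z * gcd assms(3) in \<open>simp only: insert_iff empty_iff simp_thms\<close>;
        elim disjE; simp add: power2_eq_square gcds)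
qed

section \<open>The Frobenius number and its two bounds\<close>

theorem theorem3:
  fixes n :: nat and a :: "nat \<Rightarrow> nat"
  assumes "n \<ge> 3"
    and "\<forall>i\<in>{1..n}. a i > 0"
    and "\<forall>i\<in>{1..<n}. a i \<le> a (i + 1)"
    and "\<forall>i\<in>{1..n}. \<forall>j\<in>{1..n}. i \<noteq> j \<longrightarrow> gcd (a i) (a j) = 1"
  shows "real_of_int (frobenius_number n a) \<le> UB1 (real (a 1)) (real (a 2)) (real (a 3)) \<and>
    real_of_int (frobenius_number n a) \<le> UB2 (real (a 1)) (real (a 2)) (real (a 3)) \<and>
    (UB2 (real (a 1)) (real (a 2)) (real (a 3)) < UB1 (real (a 1)) (real (a 2)) (real (a 3)) \<longrightarrow>
      (a 1, a 2, a 3) \<in>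
       {(1,2,3), (1,2,5), (1,2,7), (1,2,9), (1,2,11), (1,2,13), (1,2,15),
        (1,2,17), (1,2,19), (1,2,21), (1,2,23), (1,2,25), (1,3,4), (1,3,5),
        (1,3,7), (1,3,8), (1,3,10), (1,3,11), (1,3,13), (1,3,14), (1,4,5),
        (1,4,7), (1,4,9), (1,4,11), (1,5,6), (1,5,7), (1,5,8), (1,5,9), (1,6,7), (2,3,5)}
      \<or> (a 1 = 1 \<and> a 2 = 1))"
proof -
  define x y z where "x = a 1" and "y = a 2" and "z = a 3"
  have pos: "x > 0" "y > 0" "z > 0" using assms(1,2) by (simp_all add: x_def y_def z_def)
  have cop: "coprime x y" "coprime x z" "coprime y z"
    using assms(1,4) by (auto simp: x_def y_def z_def coprime_iff_gcd_eq_1)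
  have "a 1 \<le> a (1 + 1)" "a 2 \<le> a (2 + 1)"
    by (rule assms(3)[rule_format]; use assms(1) in simp)+
  then have le: "x \<le> y" "y \<le> z"
    by (simp_all add: x_def y_def z_def numeral_eq_Suc)
  define P where "P = (\<lambda>b::int. \<forall>z::nat \<Rightarrow> nat. b \<noteq> (\<Sum>i=1..n. int (a i) * int (z i)))"
  define K where "K = (int x)\<^sup>2 + (int y)\<^sup>2 + (int z)\<^sup>2
    + 2 * int (x * y * z) * int (x + y + z) - 2 * int (x * y + y * z + z * x)"
  have bound: "3 * (2 * b + int (x + y + z))\<^sup>2 \<le> K" if "P b" "b \<ge> -1" for b
    unfolding K_def
  proof (rule nonrepresentable_bound[OF cop pos _ that(2)])
    fix u v w :: nat
    \<comment> \<open>A representation by the first three entries extends by zeros, so an integer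
      not represented by all entries is not represented by these three.\<close>
    define f where "f = (\<lambda>i::nat. if i = 1 then u else if i = 2 then v else if i = 3 then w else 0)"
    have "(\<Sum>i=1..n. int (a i) * int (f i)) = (\<Sum>i\<in>{1,2,3}. int (a i) * int (f i))"
      by (rule sum.mono_neutral_right) (use assms(1) in \<open>auto simp: f_def\<close>)
    also have "\<dots> = int (x * u + y * v + z * w)"
      by (simp add: f_def x_def y_def z_def)
    finally show "b \<noteq> int (x * u + y * v + z * w)"
      using that(1) unfolding P_def by metis
  qed
  \<comment> \<open>This ensures that the Frobenius number is at least -1, the value taken when some
    entry is 1.\<close>
  have "P (-1)"
  proof -
    have "(\<Sum>i=1..n. int (a i) * int (f i)) \<ge> 0" for f by (intro sum_nonneg) auto
    then show ?thesis unfolding P_def by (metis neg_0_le_iff_le not_one_le_zero)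
  qed
  have upper: "b \<le> K" if "P b" "b \<ge> -1" for b
  proof -
    \<comment> \<open>As x + y + z \<ge> 3 and b \<ge> -1, the left side is positive, hence at most
      its square. The resulting bound is crude but gives finiteness.\<close>
    have "2 * b + int (x + y + z) \<le> (2 * b + int (x + y + z))\<^sup>2"
      by (rule self_le_power) (use pos that in auto)
    then show ?thesis using bound[OF that] that pos by auto
  qed
  \<comment> \<open>The nonrepresentable integers are unbounded below; cutting them off at -1 gives
    a finite set with the same maximum.\<close>
  define A where "A = {-1..K} \<inter> Collect P"
  have A: "finite A" "-1 \<in> A"
    using \<open>P (-1)\<close> upper[of "-1"] by (simp_all add: A_def)
  have "frobenius_number n a = Max A"
    unfolding frobenius_number_def P_def[symmetric]
  proof (rule Greatest_equality)
    show "P (Max A)" using Max_in[of A] A unfolding A_def by blast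
    fix b assume "P b"
    show "b \<le> Max A"
    proof (cases "b \<ge> -1")
      case True
      then show ?thesis using A \<open>P b\<close> upper by (intro Max_ge) (auto simp: A_def)
    next
      case False
      then show ?thesis using Max_ge[OF A] by linarith
    qed
  qed
  then have "frobenius_number n a \<in> A" using Max_in[of A] A by (metis empty_iff)
  then have F: "3 * (2 * frobenius_number n a + int (x + y + z))\<^sup>2 \<le> K"
    using bound by (auto simp: A_def)
  define f p q t where "f = real_of_int (frobenius_number n a)"
    and "p = real x" and "q = real y" and "t = real z"
  have pqt: "p \<ge> 1" "q \<ge> 1" "t \<ge> 1" using pos by (auto simp: p_def q_def t_def)
  have "real_of_int (3 * (2 * frobenius_number n a + int (x + y + z))\<^sup>2) \<le> real_of_int K"
    using F by (simp only: of_int_le_iff)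
  then have Fr: "3 * (2 * f + p + q + t)\<^sup>2 \<le> p\<^sup>2 + q\<^sup>2 + t\<^sup>2 + 2 * (p * q * t * (p + q + t))
      - 2 * (p * q + q * t + t * p)"
    by (simp add: K_def f_def p_def q_def t_def algebra_simps)
  have nonneg: "0 \<le> p * q" "0 \<le> q * t" "0 \<le> t * p" using pqt by auto
  \<comment> \<open>With s = p + q + t and e = pq + qt + tp, the right side of \<open>Fr\<close>
    contains s^2 - 4e, which is at most s^2 + 8e.\<close>
  have "3 * (2 * f + p + q + t)\<^sup>2 \<le> (p + q + t) * (p + q + t + 2 * p * q * t)
      + 8 * (p * q + q * t + t * p)"
    using Fr nonneg by (simp add: power2_eq_square algebra_simps)
  then have "(2 * f + p + q + t)\<^sup>2 \<le> 1/3 * (p + q + t) * (p + q + t + 2 * p * q * t)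
      + 8/3 * (p * q + q * t + t * p)"
    by (simp add: field_simps)
  then have "2 * f + p + q + t \<le> sqrt (1/3 * (p + q + t) * (p + q + t + 2 * p * q * t)
      + 8/3 * (p * q + q * t + t * p))"
    by (rule real_le_rsqrt)
  then have "f \<le> UB1 p q t" by (simp add: UB1_def)
  \<comment> \<open>This turns the right side of \<open>Fr\<close> into at most three times the
    radicand of \<open>UB2\<close>.\<close>
  moreover have "p\<^sup>2 + q\<^sup>2 + t\<^sup>2 \<le> (p * q * t) * (p + q + t)"
  proof -
    have "1 * 1 \<le> q * t" "1 * 1 \<le> p * q" "1 * 1 \<le> p * t"
      using pqt by (intro mult_mono; simp)+
    then have "p\<^sup>2 * 1 \<le> p\<^sup>2 * (q * t)" "q\<^sup>2 * 1 \<le> q\<^sup>2 * (p * t)" "t\<^sup>2 * 1 \<le> t\<^sup>2 * (p * q)"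
      by (intro mult_left_mono; simp)+
    then show ?thesis by (simp add: power2_eq_square algebra_simps)
  qed
  then have "(2 * f + p + q + t)\<^sup>2 \<le> p * q * t * (p + q + t)"
    using Fr nonneg by argo
  then have "2 * f + p + q + t \<le> sqrt (p * q * t * (p + q + t))"
    by (rule real_le_rsqrt)
  then have "f \<le> UB2 p q t" by (simp add: UB2_def)
  moreover have "(x, y, z) \<in>
       {(1,2,3), (1,2,5), (1,2,7), (1,2,9), (1,2,11), (1,2,13), (1,2,15),
        (1,2,17), (1,2,19), (1,2,21), (1,2,23), (1,2,25), (1,3,4), (1,3,5),
        (1,3,7), (1,3,8), (1,3,10), (1,3,11), (1,3,13), (1,3,14), (1,4,5),
        (1,4,7), (1,4,9), (1,4,11), (1,5,6), (1,5,7), (1,5,8), (1,5,9), (1,6,7), (2,3,5)}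
      \<or> (x = 1 \<and> y = 1)" if "UB2 p q t < UB1 p q t"
  proof (cases "y = 1")
    \<comment> \<open>Coprimality allows the entry 1 to repeat. For (1, 1, t) the bound
      \<open>UB2\<close> is sharper for every t, so this family is a separate alternative; otherwise
      the three entries are distinct.\<close>
    case True
    then show ?thesis using le pos by simp
  next
    case False
    then have "x \<noteq> y" "y \<noteq> z" using cop by auto
    then have "x < y" "y < z" using le by auto
    moreover have "UB2 (real x) (real y) (real z) < UB1 (real x) (real y) (real z)"
      using that by (simp only: p_def q_def t_def)
    ultimately show ?thesis
      by (intro disjI1 UB2_sharper_cases[OF pos(1) _ _ cop] UB2_less_UB1_imp[OF pos])
  qed
  ultimately show ?thesis
    unfolding f_def p_def q_def t_def x_def y_def z_def by (intro conjI impI)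
qed

end
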